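(* Let $X$ be an operator space generating a TRO $T$. Suppose $\omega:C^*(\mathcal S(X))\to B(L_\omega)$ is a weak boundary representation for the Paulsen system $\mathcal S(X)$ associated with $X$. Then one can decompose $L_\omega$ as an orthogonal direct sum $K_\omega\oplus H_\omega$ in such a way that $\omega=\mathcal S(\theta)$ (meaning $\omega|_{\mathcal S(X)}=\mathcal S(\theta|_X)$) for some weak boundary representation $\theta:T\to B(H_\omega,K_\omega)$ for $X$.
   Context: A ternary ring of operators (TRO) is a norm closed subspace $T\subset B(H_0,K_0)$ with $xy^*z\in T$ for all $x,y,z\in T$. A triple morphism (representation of $T$) is a linear map $\theta:T\to B(H,K)$ with $\theta(xy^*z)=\theta(x)\theta(y)^*\theta(z)$. It is irreducible if, whenever $p\in B(H)$, $q\in B(K)$ are projections with $q\theta(t)=\theta(t)p$ for all $t\in T$, either $p=0,q=0$ or $p=1,q=1$. For $X\subset T\subset B(H_0,K_0)$, the Paulsen system is $\mathcal S(X)=\left\{\begin{bmatrix} \lambda I_{K_0} & x \\ y^* & \mu I_{H_0} \end{bmatrix}:x,y\in X,\ \lambda,\mu\in\mathbb C\right\}\subset B(K_0\oplus H_0)$, and $C^*(\mathcal S(X))$ is the $C^*$-algebra it generates. For a completely contractive $\phi:X\to B(H,K)$, $\mathcal S(\phi):\mathcal S(X)\to B(K\oplus H)$ is the unital completely positive map $\begin{bmatrix} \lambda I_{K_0} & x \\ y^* & \mu I_{H_0} \end{bmatrix}\mapsto\begin{bmatrix} \lambda I_K & \phi(x) \\ \phi(y)^* & \mu I_H \end{bmatrix}$.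 Weak boundary representation for an operator space: an irreducible triple morphism $\psi:T\to B(H,K)$ is a weak boundary representation for $X$ if $\psi|_X$ has a unique extension of the form $v^*\psi u$, namely $\psi$ itself, where $u:H\to H$ and $v:K\to K$ are isometries; that is, whenever $u,v$ are such isometries with $v^*\psi(x)u=\psi(x)$ for all $x\in X$, then $v^*\psi(t)u=\psi(t)$ for all $t\in T$. Weak boundary representation for an operator system $S$: an irreducible $*$-representation $\omega:C^*(S)\to B(L)$ such that whenever $V:L\to L$ is an isometry with $V^*\omega(s)V=\omega(s)$ for all $s\in S$, then $V^*\omega(a)V=\omega(a)$ for all $a\in C^*(S)$. *)

theory Defs
  imports "HOL-Analysis.Analysis"
begin

section \<open>Complex Hilbert spaces\<close>

class scaleC =
  fixes scaleC :: "complex \<Rightarrow> 'a \<Rightarrow> 'a"  (infixr \<open>*\<^sub>C\<close> 75)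

class complex_vector = real_vector + scaleC +
  assumes scaleC_add_right: "c *\<^sub>C (x + y) = c *\<^sub>C x + c *\<^sub>C y"
    and scaleC_add_left: "(c + d) *\<^sub>C x = c *\<^sub>C x + d *\<^sub>C x"
    and scaleC_scaleC: "c *\<^sub>C d *\<^sub>C x = (c * d) *\<^sub>C x"
    and scaleR_scaleC: "r *\<^sub>R x = complex_of_real r *\<^sub>C x"

text \<open>The complex inner product is linear in its first argument. Its real part is the inner product
  of the underlying real Hilbert space, so that norm and topology are those of \<^class>\<open>real_inner\<close>.\<close>

class complex_inner = complex_vector + real_inner +
  fixes cinner :: "'a \<Rightarrow> 'a \<Rightarrow> complex"
  assumes cinner_commute: "cinner x y = cnj (cinner y x)"
    and cinner_add_left: "cinner (x + y) z = cinner x z + cinner y z"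
    and cinner_scaleC_left: "cinner (c *\<^sub>C x) y = c * cinner x y"
    and inner_eq_Re_cinner: "inner x y = Re (cinner x y)"

class complex_hilbert = complex_inner + complete_space

global_interpretation complex_vector: vector_space "scaleC :: complex \<Rightarrow> 'a \<Rightarrow> 'a::complex_vector"
  defines csubspace = complex_vector.subspace
proof
  fix x :: 'a
  show "1 *\<^sub>C x = x"
    using scaleR_scaleC[of 1 x] by simp
qed (simp_all add: scaleC_add_right scaleC_add_left scaleC_scaleC)

lemma norm_scaleC: "norm (c *\<^sub>C x) = cmod c * norm (x :: 'a::complex_inner)"
proof -
  have r: "cinner x (c *\<^sub>C y) = cnj c * cinner x y" for x y :: 'a
    by (metis cinner_commute cinner_scaleC_left complex_cnj_mult)
  have "cinner (c *\<^sub>C x) (c *\<^sub>C x) = (c * cnj c) * cinner x x"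
    by (simp add: r cinner_scaleC_left)
  also have "\<dots> = complex_of_real ((cmod c)\<^sup>2) * cinner x x"
    by (simp only: complex_norm_square)
  finally have "inner (c *\<^sub>C x) (c *\<^sub>C x) = (cmod c)\<^sup>2 * inner x x"
    by (simp add: inner_eq_Re_cinner)
  then have "(norm (c *\<^sub>C x))\<^sup>2 = (cmod c * norm x)\<^sup>2"
    by (simp add: power2_norm_eq_inner power_mult_distrib)
  then show ?thesis
    by (simp add: power2_eq_iff_nonneg)
qed

lemma bounded_linear_scaleC: "bounded_linear (\<lambda>x :: 'a::complex_inner. c *\<^sub>C x)"
proof (rule bounded_linear_intro[where K = "cmod c"])
  show "c *\<^sub>C (r *\<^sub>R x) = r *\<^sub>R (c *\<^sub>C x)" for r and x :: 'a
    by (simp add: scaleR_scaleC scaleC_scaleC mult.commute)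
qed (simp_all add: scaleC_add_right norm_scaleC)

text \<open>The Hilbert space direct sum of two spaces is their product type.\<close>

instantiation prod :: (complex_vector, complex_vector) complex_vector
begin
definition "c *\<^sub>C p = (c *\<^sub>C fst p, c *\<^sub>C snd p)"
instance
  by standard
    (simp_all add: scaleC_prod_def scaleR_prod_def scaleC_add_right scaleC_add_left scaleC_scaleC
      scaleR_scaleC)
end

instantiation prod :: (complex_inner, complex_inner) complex_inner
begin
definition "cinner p q = cinner (fst p) (fst q) + cinner (snd p) (snd q)"
instance
proof
  fix p q :: "'a \<times> 'b"
  show "cinner p q = cnj (cinner q p)"
    unfolding cinner_prod_def by (metis cinner_commute complex_cnj_add)
qed (simp_all add: cinner_prod_def scaleC_prod_def inner_prod_def cinner_add_left
    cinner_scaleC_left inner_eq_Re_cinner algebra_simps)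
end

instance prod :: (complex_hilbert, complex_hilbert) complex_hilbert ..

definition closed_csubspace :: "'a::complex_inner set \<Rightarrow> bool"
  where "closed_csubspace M \<longleftrightarrow> csubspace M \<and> closed M"


section \<open>Bounded operators\<close>

instantiation blinfun :: (real_normed_vector, complex_inner) complex_vector
begin
lift_definition scaleC_blinfun :: "complex \<Rightarrow> ('a \<Rightarrow>\<^sub>L 'b) \<Rightarrow> ('a \<Rightarrow>\<^sub>L 'b)" is "\<lambda>c A x. c *\<^sub>C A x"
  by (rule bounded_linear_compose[OF bounded_linear_scaleC])
instance
  by standard
    (transfer; simp add: scaleC_add_right scaleC_add_left scaleC_scaleC scaleR_scaleC)+
end

text \<open>For closed subspaces \<open>H\<close> and \<open>K\<close>, the operators from \<open>H\<close> to \<open>K\<close> are represented as operators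
  on the ambient spaces: those with range in \<open>K\<close> that vanish on the orthogonal complement of \<open>H\<close>.
  This identification preserves norms, products and adjoints; the identity of \<open>H\<close> becomes the
  orthogonal projection onto \<open>H\<close>.\<close>

definition bop :: "'a::complex_inner set \<Rightarrow> 'b::complex_inner set \<Rightarrow> ('a \<Rightarrow>\<^sub>L 'b) set"
  where "bop H K = {A :: 'a \<Rightarrow>\<^sub>L 'b. (\<forall>c x. A (c *\<^sub>C x) = c *\<^sub>C A x) \<and> (\<forall>x. A x \<in> K) \<and>
    (\<forall>x. (\<forall>h\<in>H. cinner x h = 0) \<longrightarrow> A x = 0)}"

definition adj :: "('a::complex_hilbert \<Rightarrow>\<^sub>L 'b::complex_hilbert) \<Rightarrow> ('b \<Rightarrow>\<^sub>L 'a)"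
  where "adj A = (THE B. \<forall>x y. cinner (blinfun_apply A x) y = cinner x (blinfun_apply B y))"

definition isometry_on :: "'a::complex_inner set \<Rightarrow> ('a \<Rightarrow>\<^sub>L 'a) \<Rightarrow> bool"
  where "isometry_on H u \<longleftrightarrow> u \<in> bop H H \<and> (\<forall>h\<in>H. norm (u h) = norm h)"

definition projection_on :: "'a::complex_hilbert set \<Rightarrow> ('a \<Rightarrow>\<^sub>L 'a) \<Rightarrow> bool"
  where "projection_on H p \<longleftrightarrow> p \<in> bop H H \<and> p o\<^sub>L p = p \<and> adj p = p"

definition clinear_on :: "'a::complex_vector set \<Rightarrow> ('a \<Rightarrow> 'b::complex_vector) \<Rightarrow> bool"
  where "clinear_on S f \<longleftrightarrow>
    (\<forall>x\<in>S. \<forall>y\<in>S. f (x + y) = f x + f y) \<and> (\<forall>c. \<forall>x\<in>S. f (c *\<^sub>C x) = c *\<^sub>C f x)"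


section \<open>Ternary rings of operators\<close>

definition operator_space :: "('h::complex_hilbert \<Rightarrow>\<^sub>L 'k::complex_hilbert) set \<Rightarrow> bool"
  where "operator_space X \<longleftrightarrow> X \<subseteq> bop UNIV UNIV \<and> csubspace X"

definition is_tro :: "('h::complex_hilbert \<Rightarrow>\<^sub>L 'k::complex_hilbert) set \<Rightarrow> bool"
  where "is_tro T \<longleftrightarrow> operator_space T \<and> closed T \<and>
    (\<forall>x\<in>T. \<forall>y\<in>T. \<forall>z\<in>T. x o\<^sub>L adj y o\<^sub>L z \<in> T)"

definition triple_morphism ::
  "('h::complex_hilbert \<Rightarrow>\<^sub>L 'k::complex_hilbert) set \<Rightarrow> 'a::complex_hilbert set \<Rightarrow>
    'b::complex_hilbert set \<Rightarrow> (('h \<Rightarrow>\<^sub>L 'k) \<Rightarrow> ('a \<Rightarrow>\<^sub>L 'b)) \<Rightarrow> bool"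
  where "triple_morphism T H K \<theta> \<longleftrightarrow>
    closed_csubspace H \<and> closed_csubspace K \<and> \<theta> ` T \<subseteq> bop H K \<and> clinear_on T \<theta> \<and>
    (\<forall>x\<in>T. \<forall>y\<in>T. \<forall>z\<in>T. \<theta> (x o\<^sub>L adj y o\<^sub>L z) = \<theta> x o\<^sub>L adj (\<theta> y) o\<^sub>L \<theta> z)"

definition irreducible_triple_morphism ::
  "('h::complex_hilbert \<Rightarrow>\<^sub>L 'k::complex_hilbert) set \<Rightarrow> 'a::complex_hilbert set \<Rightarrow>
    'b::complex_hilbert set \<Rightarrow> (('h \<Rightarrow>\<^sub>L 'k) \<Rightarrow> ('a \<Rightarrow>\<^sub>L 'b)) \<Rightarrow> bool"
  where "irreducible_triple_morphism T H K \<theta> \<longleftrightarrow> triple_morphism T H K \<theta> \<and>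
    (\<forall>p q. projection_on H p \<and> projection_on K q \<and> (\<forall>t\<in>T. q o\<^sub>L \<theta> t = \<theta> t o\<^sub>L p) \<longrightarrow>
      (p = 0 \<and> q = 0) \<or> ((\<forall>h\<in>H. p h = h) \<and> (\<forall>k\<in>K. q k = k)))"

definition weak_boundary_triple ::
  "('h::complex_hilbert \<Rightarrow>\<^sub>L 'k::complex_hilbert) set \<Rightarrow> ('h \<Rightarrow>\<^sub>L 'k) set \<Rightarrow>
    'a::complex_hilbert set \<Rightarrow> 'b::complex_hilbert set \<Rightarrow> (('h \<Rightarrow>\<^sub>L 'k) \<Rightarrow> ('a \<Rightarrow>\<^sub>L 'b)) \<Rightarrow> bool"
  where "weak_boundary_triple X T H K \<psi> \<longleftrightarrow> irreducible_triple_morphism T H K \<psi> \<and>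
    (\<forall>u v. isometry_on H u \<and> isometry_on K v \<and> (\<forall>x\<in>X. adj v o\<^sub>L \<psi> x o\<^sub>L u = \<psi> x) \<longrightarrow>
      (\<forall>t\<in>T. adj v o\<^sub>L \<psi> t o\<^sub>L u = \<psi> t))"


section \<open>C*-algebras and their representations\<close>

definition is_cstar_subalgebra :: "('a::complex_hilbert \<Rightarrow>\<^sub>L 'a) set \<Rightarrow> bool"
  where "is_cstar_subalgebra A \<longleftrightarrow> A \<subseteq> bop UNIV UNIV \<and> csubspace A \<and> closed A \<and>
    (\<forall>a\<in>A. \<forall>b\<in>A. a o\<^sub>L b \<in> A) \<and> (\<forall>a\<in>A. adj a \<in> A)"

definition cstar :: "('a::complex_hilbert \<Rightarrow>\<^sub>L 'a) set \<Rightarrow> ('a \<Rightarrow>\<^sub>L 'a) set"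
  where "cstar S = is_cstar_subalgebra hull S"

text \<open>The C*-algebras represented here contain the identity operator, and representations are
  nondegenerate, that is, unital.\<close>

definition star_rep ::
  "('a::complex_hilbert \<Rightarrow>\<^sub>L 'a) set \<Rightarrow> (('a \<Rightarrow>\<^sub>L 'a) \<Rightarrow> ('l::complex_hilbert \<Rightarrow>\<^sub>L 'l)) \<Rightarrow> bool"
  where "star_rep A \<omega> \<longleftrightarrow> \<omega> ` A \<subseteq> bop UNIV UNIV \<and> clinear_on A \<omega> \<and>
    (\<forall>a\<in>A. \<forall>b\<in>A. \<omega> (a o\<^sub>L b) = \<omega> a o\<^sub>L \<omega> b) \<and> (\<forall>a\<in>A. \<omega> (adj a) = adj (\<omega> a)) \<and>
    \<omega> id_blinfun = id_blinfun"

definition irreducible_star_rep ::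
  "('a::complex_hilbert \<Rightarrow>\<^sub>L 'a) set \<Rightarrow> (('a \<Rightarrow>\<^sub>L 'a) \<Rightarrow> ('l::complex_hilbert \<Rightarrow>\<^sub>L 'l)) \<Rightarrow> bool"
  where "irreducible_star_rep A \<omega> \<longleftrightarrow> star_rep A \<omega> \<and>
    (\<forall>M. closed_csubspace M \<and> (\<forall>a\<in>A. \<forall>x\<in>M. \<omega> a x \<in> M) \<longrightarrow> M = {0} \<or> M = UNIV)"

definition weak_boundary_star_rep ::
  "('a::complex_hilbert \<Rightarrow>\<^sub>L 'a) set \<Rightarrow> (('a \<Rightarrow>\<^sub>L 'a) \<Rightarrow> ('l::complex_hilbert \<Rightarrow>\<^sub>L 'l)) \<Rightarrow> bool"
  where "weak_boundary_star_rep S \<omega> \<longleftrightarrow> irreducible_star_rep (cstar S) \<omega> \<and>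
    (\<forall>V. isometry_on UNIV V \<and> (\<forall>s\<in>S. adj V o\<^sub>L \<omega> s o\<^sub>L V = \<omega> s) \<longrightarrow>
      (\<forall>a\<in>cstar S. adj V o\<^sub>L \<omega> a o\<^sub>L V = \<omega> a))"


section \<open>The Paulsen system\<close>

lift_definition block_op ::
  "('k::complex_inner \<Rightarrow>\<^sub>L 'k) \<Rightarrow> ('h::complex_inner \<Rightarrow>\<^sub>L 'k) \<Rightarrow> ('k \<Rightarrow>\<^sub>L 'h) \<Rightarrow> ('h \<Rightarrow>\<^sub>L 'h) \<Rightarrow>
    (('k \<times> 'h) \<Rightarrow>\<^sub>L ('k \<times> 'h))"
  is "\<lambda>a b c d p. (a (fst p) + b (snd p), c (fst p) + d (snd p))"
  by (intro bounded_linear_Pair bounded_linear_add)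
    (auto intro: bounded_linear_compose bounded_linear_fst bounded_linear_snd)

definition paulsen_elem ::
  "complex \<Rightarrow> ('h::complex_hilbert \<Rightarrow>\<^sub>L 'k::complex_hilbert) \<Rightarrow> ('h \<Rightarrow>\<^sub>L 'k) \<Rightarrow> complex \<Rightarrow>
    (('k \<times> 'h) \<Rightarrow>\<^sub>L ('k \<times> 'h))"
  where "paulsen_elem l x y m = block_op (l *\<^sub>C id_blinfun) x (adj y) (m *\<^sub>C id_blinfun)"

definition paulsen_system ::
  "('h::complex_hilbert \<Rightarrow>\<^sub>L 'k::complex_hilbert) set \<Rightarrow> (('k \<times> 'h) \<Rightarrow>\<^sub>L ('k \<times> 'h)) set"
  where "paulsen_system X = {paulsen_elem l x y m | l x y m. x \<in> X \<and> y \<in> X}"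

definition orthogonal_decomposition :: "'l::complex_inner set \<Rightarrow> 'l set \<Rightarrow> bool"
  where "orthogonal_decomposition K H \<longleftrightarrow> closed_csubspace K \<and> closed_csubspace H \<and>
    (\<forall>k\<in>K. \<forall>h\<in>H. cinner k h = 0) \<and> (\<forall>x. \<exists>k\<in>K. \<exists>h\<in>H. x = k + h)"

text \<open>For an orthogonal decomposition of the ambient space into \<open>K\<close> and \<open>H\<close>, the following says
  that \<open>\<Phi>\<close> restricts on the Paulsen system of \<open>X\<close> to the map induced by \<open>\<phi>\<close>: the vector \<open>k + h\<close> is
  the column with entries \<open>k\<close> and \<open>h\<close>, to which the operator matrix with rows
  \<open>l I, \<phi> x\<close> and \<open>(\<phi> y)*, m I\<close> is applied.\<close>

definition restricts_to_paulsen_map ::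
  "('h::complex_hilbert \<Rightarrow>\<^sub>L 'k::complex_hilbert) set \<Rightarrow> 'l::complex_hilbert set \<Rightarrow> 'l set \<Rightarrow>
    (('h \<Rightarrow>\<^sub>L 'k) \<Rightarrow> ('l \<Rightarrow>\<^sub>L 'l)) \<Rightarrow>
    ((('k \<times> 'h) \<Rightarrow>\<^sub>L ('k \<times> 'h)) \<Rightarrow> ('l \<Rightarrow>\<^sub>L 'l)) \<Rightarrow> bool"
  where "restricts_to_paulsen_map X K H \<phi> \<Phi> \<longleftrightarrow>
    (\<forall>l m. \<forall>x\<in>X. \<forall>y\<in>X. \<forall>k\<in>K. \<forall>h\<in>H.
      \<Phi> (paulsen_elem l x y m) (k + h) = (l *\<^sub>C k + \<phi> x h) + (adj (\<phi> y) k + m *\<^sub>C h))"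

end

theory Submission
  imports Defs
begin

text \<open>The diagonal projections \<open>P\<close> and \<open>Q\<close> lie in the Paulsen system, so \<open>L\<close> splits into the ranges
  \<open>K\<close> of \<open>\<omega> P\<close> and \<open>H\<close> of \<open>\<omega> Q\<close>. The operators \<open>t\<close> whose upper right corner embedding lies in
  \<open>C*(S(X))\<close> form a TRO, hence include \<open>T\<close>, and \<open>\<theta> t\<close> is the image under \<open>\<omega>\<close> of that embedding.
  If projections \<open>r\<close> on \<open>H\<close> and \<open>s\<close> on \<open>K\<close> intertwine \<open>\<theta>\<close>, then \<open>r + s\<close> commutes with
  \<open>\<omega>(S(X))\<close>, hence, \<open>\<omega>\<close> being continuous, with \<open>\<omega>(C*(S(X)))\<close>, so it is \<open>0\<close> or \<open>1\<close>. If isometries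
  \<open>u\<close>, \<open>v\<close> satisfy \<open>v* \<theta> u = \<theta>\<close> on \<open>X\<close>, then the isometry \<open>V = u + v\<close> satisfies \<open>V* \<omega> V = \<omega>\<close> on
  \<open>S(X)\<close>, hence on the corners from \<open>T\<close>.\<close>

section \<open>Adjoints\<close>

instance complex_hilbert \<subseteq> banach ..

section \<open>Elementary rules for the complex inner product\<close>

lemma cinner_add_right: "cinner x (y + z) = cinner x y + cinner x (z :: 'a::complex_inner)"
  by (metis cinner_add_left cinner_commute complex_cnj_add)

lemma cinner_diff_left: "cinner (x - y) z = cinner x z - cinner y (z :: 'a::complex_inner)"
  by (metis cinner_add_left add_diff_cancel diff_add_cancel)

lemma cinner_diff_right: "cinner x (y - z) = cinner x y - cinner x (z :: 'a::complex_inner)"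
  by (metis cinner_add_right add_diff_cancel diff_add_cancel)

lemma cinner_scaleC_right: "cinner x (c *\<^sub>C y) = cnj c * cinner x (y :: 'a::complex_inner)"
  by (metis cinner_commute cinner_scaleC_left complex_cnj_mult)

text \<open>Since Im z = - Re (i z), the real inner product determines the complex one, which lets
  real results such as Riesz representation carry over.\<close>

lemma cinner_eq_inner: "cinner x y = Complex (inner x y) (- inner (\<i> *\<^sub>C x) (y :: 'a::complex_inner))"
  by (simp add: complex_eq_iff inner_eq_Re_cinner cinner_scaleC_left)

lemma cinner_0 [simp]:
  fixes x :: "'a::complex_inner"
  shows "cinner 0 x = 0" "cinner x 0 = 0"
  by (simp_all add: cinner_eq_inner complex_eq_iff)

lemma cinner_eqI:
  fixes y z :: "'a::complex_inner"
  assumes "\<And>x. cinner x y = cinner x z"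
  shows "y = z"
proof -
  have "inner (y - z) y = inner (y - z) z"
    by (simp add: inner_eq_Re_cinner assms)
  then have "inner (y - z) (y - z) = 0"
    by (simp add: inner_diff_right)
  then show ?thesis by simp
qed

text \<open>The representing vector minimises \<open>\<parallel>x\<parallel>\<^sup>2 / 2 - f x\<close>.\<close>

lemma riesz_representation:
  fixes f :: "'a::{real_inner, complete_space} \<Rightarrow> real"
  assumes "bounded_linear f"
  shows "\<exists>z. \<forall>x. f x = inner x z"
proof -
  interpret f: bounded_linear f by fact
  define J where "J x = (norm x)\<^sup>2 / 2 - f x" for x
  obtain C where C: "\<And>x. \<bar>f x\<bar> \<le> norm x * C"
    using f.bounded by auto
  \<comment> \<open>Completing the square bounds \<open>J\<close> from below, so its infimum
    \<open>m\<close> is finite and minimising sequences exist.\<close>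
  have low: "- C\<^sup>2 / 2 \<le> J x" for x
  proof -
    have "0 \<le> (norm x - C)\<^sup>2" by simp
    then have "norm x * C \<le> (norm x)\<^sup>2 / 2 + C\<^sup>2 / 2"
      by (simp add: power2_diff)
    with C[of x] show ?thesis
      by (simp add: J_def field_simps)
  qed
  define m where "m = Inf (range J)"
  have bdd: "bdd_below (range J)"
    using low by (auto intro!: bdd_belowI)
  have mJ: "m \<le> J x" for x
    unfolding m_def using bdd by (auto intro: cInf_lower)
  have "\<exists>x. J x < m + 1 / real (Suc n)" for n
    using cInf_lessD[of "range J" "m + 1 / real (Suc n)"] by (auto simp: m_def)
  then obtain X where X: "\<And>n. J (X n) < m + 1 / real (Suc n)"
    by metis
  \<comment> \<open>At the midpoint \<open>J\<close> is again at least \<open>m\<close>; by the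
    parallelogram law two near-minimisers are then close, so a minimising sequence is
    Cauchy.\<close>
  have par: "(norm (x - y))\<^sup>2 \<le> 4 * (J x - m) + 4 * (J y - m)" for x y
  proof -
    have "J ((1/2) *\<^sub>R (x + y)) = (norm (x + y))\<^sup>2 / 8 - (f x + f y) / 2"
      by (simp add: J_def f.scaleR f.add power_divide del: scaleR_add_right)
    with mJ[of "(1/2) *\<^sub>R (x + y)"] have "m \<le> (norm (x + y))\<^sup>2 / 8 - (f x + f y) / 2"
      by simp
    moreover have "(norm (x - y))\<^sup>2 = 2 * (norm x)\<^sup>2 + 2 * (norm y)\<^sup>2 - (norm (x + y))\<^sup>2"
      by (simp add: power2_norm_eq_inner inner_add_left inner_add_right inner_diff_left
          inner_diff_right inner_commute)
    ultimately show ?thesis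
      by (simp add: J_def field_simps)
  qed
  have "Cauchy X"
  proof (rule metric_CauchyI)
    fix e :: real
    assume "0 < e"
    \<comment> \<open>The bound \<open>e\<^sup>2 / 8\<close> makes the two terms 4 (J - m) of
      \<open>par\<close> add up to less than \<open>e\<^sup>2\<close>.\<close>
    then obtain N where N: "1 / real (Suc N) < e\<^sup>2 / 8"
      using nat_approx_posE[of "e\<^sup>2 / 8"] by auto
    have "dist (X i) (X j) < e" if "i \<ge> N" "j \<ge> N" for i j
    proof -
      have le: "J (X k) - m < e\<^sup>2 / 8" if "k \<ge> N" for k
      proof -
        have "1 / real (Suc k) \<le> 1 / real (Suc N)"
          using that by (intro divide_left_mono) auto
        with X[of k] N show ?thesis by linarith
      qed
      have "(norm (X i - X j))\<^sup>2 < e\<^sup>2"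
        using par[of "X i" "X j"] le[OF that(1)] le[OF that(2)] by (simp add: field_simps)
      then show ?thesis
        using \<open>0 < e\<close> by (simp add: dist_norm power2_less_imp_less)
    qed
    then show "\<exists>M. \<forall>m\<ge>M. \<forall>n\<ge>M. dist (X m) (X n) < e" by blast
  qed
  then obtain z where z: "X \<longlonglongrightarrow> z"
    by (metis Cauchy_convergent_iff convergent_def)
  have "(\<lambda>n. J (X n)) \<longlonglongrightarrow> J z"
    unfolding J_def by (intro tendsto_intros z f.tendsto) simp
  moreover have "(\<lambda>n. m + 1 / real (Suc n)) \<longlonglongrightarrow> m + 0"
    by (intro tendsto_intros LIMSEQ_Suc[OF lim_1_over_n])
  ultimately have "J z \<le> m + 0"
    by (rule LIMSEQ_le) (use X in \<open>auto intro!: less_imp_le\<close>)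
  with mJ[of z] have Jz: "J z = m" by simp
  \<comment> \<open>Minimality of \<open>z\<close> along the line in direction \<open>x\<close>; the
    linear coefficient is forced to be 0.\<close>
  have quad: "0 \<le> t * (inner x z - f x) + t\<^sup>2 * (norm x)\<^sup>2 / 2" for t x
  proof -
    have "(norm (z + t *\<^sub>R x))\<^sup>2 = (norm z)\<^sup>2 + 2 * t * inner x z + t\<^sup>2 * (norm x)\<^sup>2"
      unfolding power2_norm_eq_inner
      by (simp add: inner_add_left inner_add_right inner_commute power2_eq_square algebra_simps)
    then have "J (z + t *\<^sub>R x) = J z + t * (inner x z - f x) + t\<^sup>2 * (norm x)\<^sup>2 / 2"
      by (simp add: J_def f.add f.scaleR field_simps)
    with mJ[of "z + t *\<^sub>R x"] Jz show ?thesis by simp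
  qed
  have "f x = inner x z" for x
  proof (rule ccontr)
    assume ne: "f x \<noteq> inner x z"
    \<comment> \<open>The choice \<open>t = - d / b\<close> in \<open>quad\<close> gives a negative
      value; the added 1 keeps \<open>b\<close> positive even for \<open>x = 0\<close>.\<close>
    define d where "d = inner x z - f x"
    define b where "b = (norm x)\<^sup>2 + 1"
    have b: "b > 0" unfolding b_def by (simp add: add_nonneg_pos)
    have "0 \<le> (- d / b) * d + (- d / b)\<^sup>2 * (norm x)\<^sup>2 / 2"
      using quad[of "- d / b" x] by (simp add: d_def)
    also have "\<dots> \<le> (- d / b) * d + (- d / b)\<^sup>2 * b / 2"
      by (intro add_left_mono divide_right_mono mult_left_mono) (auto simp: b_def)
    also have "\<dots> = - (d\<^sup>2 / b) / 2"
      using b by (simp add: power2_eq_square field_simps)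
    also have "\<dots> < 0"
      using ne b by (simp add: d_def)
    finally show False by simp
  qed
  then show ?thesis by blast
qed

text \<open>Only 0 is orthogonal to the whole space, so what remains of \<open>bop\<close> is
  complex linearity, a genuine restriction on bounded real-linear maps.\<close>

lemma bop_UNIV_iff:
  "A \<in> bop UNIV UNIV \<longleftrightarrow> (\<forall>c x. blinfun_apply A (c *\<^sub>C x) = c *\<^sub>C blinfun_apply A x)"
proof -
  have "x = 0" if "\<forall>h. cinner x h = 0" for x :: 'a
  proof -
    from that have "inner x x = 0" by (simp add: inner_eq_Re_cinner)
    then show ?thesis by simp
  qed
  then show ?thesis
    by (auto simp: bop_def) (metis blinfun.zero_right)
qed

lemma bop_UNIV_scaleC [simp]:
  "A \<in> bop UNIV UNIV \<Longrightarrow> blinfun_apply A (c *\<^sub>C x) = c *\<^sub>C blinfun_apply A x"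
  by (simp add: bop_UNIV_iff)

section \<open>Existence, uniqueness and algebra of adjoints\<close>

lemma adj_eqI:
  assumes "\<And>x y. cinner (blinfun_apply A x) y = cinner x (blinfun_apply B y)"
  shows "adj A = B"
  unfolding adj_def
proof (rule the_equality)
  fix B'
  assume "\<forall>x y. cinner (blinfun_apply A x) y = cinner x (blinfun_apply B' y)"
  then show "B' = B"
    by (intro blinfun_eqI cinner_eqI) (metis assms)
qed (use assms in blast)

text \<open>The imaginary part of \<open>cinner\<close> is a real inner product with the first
  argument multiplied by i, up to sign, and \<open>A\<close> commutes with that
  multiplication.\<close>

lemma cinner_adj_if_inner_adj:
  assumes "A \<in> bop UNIV UNIV"
    and "\<And>x y. inner (blinfun_apply A x) y = inner x (B y)"
  shows "cinner (blinfun_apply A x) y = cinner x (B y)"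
  using assms(1) by (simp add: cinner_eq_inner assms(2) flip: bop_UNIV_scaleC)

text \<open>Riesz representation of the functional sending x to the inner product of A x and y
  provides the adjoint pointwise; linearity and boundedness in y remain to be shown before it is an
  operator.\<close>

lemma cinner_adj:
  fixes A :: "'a::complex_hilbert \<Rightarrow>\<^sub>L 'b::complex_hilbert"
  assumes A: "A \<in> bop UNIV UNIV"
  shows "cinner (blinfun_apply A x) y = cinner x (blinfun_apply (adj A) y)"
proof -
  have "\<exists>z. \<forall>x. inner (blinfun_apply A x) y = inner x z" for y
    by (rule riesz_representation)
      (rule bounded_linear_compose[OF bounded_linear_inner_left blinfun.bounded_linear_right])
  then obtain B where B: "\<And>x y. inner (blinfun_apply A x) y = inner x (B y)"
    by metis
  note cB = cinner_adj_if_inner_adj[OF A B]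
  have "bounded_linear B"
  proof (rule bounded_linear_intro[where K = "norm A"])
    show "B (y + z) = B y + B z" for y z
      by (rule cinner_eqI) (simp add: cinner_add_right flip: cB)
    show "B (r *\<^sub>R y) = r *\<^sub>R B y" for r y
      by (rule cinner_eqI) (simp add: cinner_scaleC_right scaleR_scaleC flip: cB)
    show "norm (B y) \<le> norm y * norm A" for y
    proof (cases "B y = 0")
      case False
      \<comment> \<open>Testing the adjoint relation at \<open>x = B y\<close> and cancelling one
        factor \<open>norm (B y)\<close> yields the bound.\<close>
      have "norm (B y) * norm (B y) = inner (blinfun_apply A (B y)) y"
        by (simp add: B power2_norm_eq_inner flip: power2_eq_square)
      also have "\<dots> \<le> norm (blinfun_apply A (B y)) * norm y"
        by (rule norm_cauchy_schwarz)
      also have "\<dots> \<le> (norm A * norm (B y)) * norm y"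
        by (intro mult_right_mono norm_blinfun) simp
      also have "\<dots> = norm (B y) * (norm y * norm A)"
        by simp
      finally show ?thesis using False by simp
    qed simp
  qed
  then have "blinfun_apply (Blinfun B) = B"
    by (rule bounded_linear_Blinfun_apply)
  with cB adj_eqI[of A "Blinfun B"] show ?thesis
    by simp
qed

lemma inner_adj:
  "A \<in> bop UNIV UNIV \<Longrightarrow> inner (blinfun_apply A x) y = inner x (blinfun_apply (adj A) y)"
  by (simp add: inner_eq_Re_cinner cinner_adj)

lemma norm_adj_le:
  assumes A: "A \<in> bop UNIV UNIV"
  shows "norm (adj A) \<le> norm A"
proof (rule norm_blinfun_bound)
  fix y
  define z where "z = blinfun_apply (adj A) y"
  show "norm z \<le> norm A * norm y"
  proof (cases "z = 0")
    case False
    have "norm z * norm z = inner z (blinfun_apply (adj A) y)"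
      by (simp add: z_def power2_norm_eq_inner flip: power2_eq_square)
    also have "\<dots> = inner (blinfun_apply A z) y"
      by (simp add: inner_adj[OF A])
    also have "\<dots> \<le> norm (blinfun_apply A z) * norm y"
      by (rule norm_cauchy_schwarz)
    also have "\<dots> \<le> (norm A * norm z) * norm y"
      by (intro mult_right_mono norm_blinfun) simp
    finally show ?thesis using False by (simp add: mult.commute mult.left_commute)
  qed simp
qed simp

lemma adj_eq_if_inner_adj:
  assumes "A \<in> bop UNIV UNIV"
    and "\<And>x y. inner (blinfun_apply A x) y = inner x (blinfun_apply B y)"
  shows "adj A = B"
  using assms by (intro adj_eqI cinner_adj_if_inner_adj)

lemma adj_in_bop [simp]:
  assumes "A \<in> bop UNIV UNIV"
  shows "adj A \<in> bop UNIV UNIV"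
  unfolding bop_UNIV_iff
  by (intro allI cinner_eqI) (simp add: cinner_scaleC_right flip: cinner_adj[OF assms])

lemma adj_adj [simp]: "A \<in> bop UNIV UNIV \<Longrightarrow> adj (adj A) = A"
  by (rule adj_eqI) (metis cinner_adj cinner_commute)

lemma bop_UNIV_intros [simp]:
  "0 \<in> bop UNIV UNIV" "id_blinfun \<in> bop UNIV UNIV"
  "A \<in> bop UNIV UNIV \<Longrightarrow> B \<in> bop UNIV UNIV \<Longrightarrow> A + B \<in> bop UNIV UNIV"
  "A \<in> bop UNIV UNIV \<Longrightarrow> B \<in> bop UNIV UNIV \<Longrightarrow> A - B \<in> bop UNIV UNIV"
  "A \<in> bop UNIV UNIV \<Longrightarrow> c *\<^sub>C A \<in> bop UNIV UNIV"
  "A \<in> bop UNIV UNIV \<Longrightarrow> C \<in> bop UNIV UNIV \<Longrightarrow> A o\<^sub>L C \<in> bop UNIV UNIV"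
  by (auto simp: bop_UNIV_iff blinfun.add_left blinfun.diff_left scaleC_blinfun.rep_eq
      scaleC_add_right complex_vector.scale_right_diff_distrib scaleC_scaleC mult.commute)

lemma adj_0 [simp]: "adj 0 = 0"
  by (rule adj_eq_if_inner_adj) auto

lemma adj_id [simp]: "adj id_blinfun = id_blinfun"
  by (rule adj_eqI) auto

lemma adj_add: "A \<in> bop UNIV UNIV \<Longrightarrow> B \<in> bop UNIV UNIV \<Longrightarrow> adj (A + B) = adj A + adj B"
  by (rule adj_eqI) (simp add: blinfun.add_left cinner_add_left cinner_add_right cinner_adj)

lemma adj_scaleC: "A \<in> bop UNIV UNIV \<Longrightarrow> adj (c *\<^sub>C A) = cnj c *\<^sub>C adj A"
  by (rule adj_eqI)
    (simp add: scaleC_blinfun.rep_eq cinner_scaleC_left cinner_scaleC_right cinner_adj)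

lemma adj_compose:
  "A \<in> bop UNIV UNIV \<Longrightarrow> B \<in> bop UNIV UNIV \<Longrightarrow> adj (A o\<^sub>L B) = adj B o\<^sub>L adj A"
  by (rule adj_eqI) (simp add: cinner_adj)

text \<open>By polarisation, norms of images determine their inner products. It serves to turn
  "isometric on a subspace" into an operator identity.\<close>

lemma adj_compose_self_cong:
  assumes A: "A \<in> bop UNIV UNIV" and B: "B \<in> bop UNIV UNIV"
    and norm: "\<And>x. norm (blinfun_apply A x) = norm (blinfun_apply B x)"
  shows "adj A o\<^sub>L A = adj B o\<^sub>L B"
proof (rule blinfun_eqI)
  fix x
  have *: "inner (blinfun_apply A y) (blinfun_apply A x) = inner (blinfun_apply B y) (blinfun_apply B x)" for y
    using norm[of "y + x"] norm[of x] norm[of y] by (simp add: blinfun.add_right dot_norm)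
  have "inner y (blinfun_apply (adj A o\<^sub>L A) x) = inner y (blinfun_apply (adj B o\<^sub>L B) x)" for y
    using * by (simp add: inner_adj[OF A] inner_adj[OF B])
  then show "blinfun_apply (adj A o\<^sub>L A) x = blinfun_apply (adj B o\<^sub>L B) x"
    by (metis vector_eq_rdot inner_commute)
qed

section \<open>Representations of C*-algebras\<close>

lemma closed_bop_UNIV: "closed (bop UNIV UNIV :: ('a::complex_inner \<Rightarrow>\<^sub>L 'b::complex_inner) set)"
proof -
  have "bop UNIV UNIV = {A :: 'a \<Rightarrow>\<^sub>L 'b. \<forall>c x. blinfun_apply A (c *\<^sub>C x) = c *\<^sub>C blinfun_apply A x}"
    by (auto simp: bop_UNIV_iff)
  also have "closed \<dots>"
    by (intro closed_Collect_all closed_Collect_eq continuous_intros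
        bounded_linear.continuous_on[OF bounded_linear_scaleC])
  finally show ?thesis .
qed

lemma csubspace_bop_UNIV: "csubspace (bop UNIV UNIV)"
  by (auto intro!: complex_vector.subspaceI)

text \<open>All closure conditions pass to intersections. That the hull consists of complex linear
  operators needs one subalgebra above \<open>S\<close>, and \<open>bop UNIV UNIV\<close> is
  one.\<close>

lemma is_cstar_subalgebra_cstar:
  assumes "S \<subseteq> bop UNIV UNIV"
  shows "is_cstar_subalgebra (cstar S)"
proof -
  have "is_cstar_subalgebra (bop UNIV UNIV :: ('a \<Rightarrow>\<^sub>L 'a) set)"
    by (simp add: is_cstar_subalgebra_def csubspace_bop_UNIV closed_bop_UNIV)
  with assms have "bop UNIV UNIV \<in> {A. is_cstar_subalgebra A \<and> S \<subseteq> A}"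
    by blast
  then show ?thesis
    unfolding cstar_def hull_def is_cstar_subalgebra_def
    by (intro conjI complex_vector.subspace_Inter closed_Inter) blast+
qed

text \<open>For \<open>\<parallel>a\<parallel> < 1\<close>, the contraction \<open>y \<mapsto> (a* a + y\<^sup>2) / 2\<close> has a self-adjoint fixed point
  \<open>y\<close> in the algebra, and then \<open>1 - a* a = (1 - y)\<^sup>2\<close>.\<close>

lemma cstar_sqrt_one_minus:
  fixes A :: "('a::complex_hilbert \<Rightarrow>\<^sub>L 'a) set"
  assumes A: "is_cstar_subalgebra A" and id: "id_blinfun \<in> A"
    and a: "a \<in> A" and lt: "norm a < 1"
  obtains b where "b \<in> A" "adj b = b" "b o\<^sub>L b = id_blinfun - (adj a o\<^sub>L a)"
proof -
  interpret comp: bounded_bilinear "blinfun_compose :: ('a \<Rightarrow>\<^sub>L 'a) \<Rightarrow> _ \<Rightarrow> ('a \<Rightarrow>\<^sub>L 'a)"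
    by (rule bounded_bilinear_blinfun_compose)
  define c where "c = adj a o\<^sub>L a"
  define r where "r = norm c"
  have A_bop: "A \<subseteq> bop UNIV UNIV" and sub: "csubspace A" and A_closed: "closed A"
    and A_mult: "\<And>a b. a \<in> A \<Longrightarrow> b \<in> A \<Longrightarrow> a o\<^sub>L b \<in> A" and A_adj: "\<And>a. a \<in> A \<Longrightarrow> adj a \<in> A"
    using A by (auto simp: is_cstar_subalgebra_def)
  have c: "c \<in> A" "adj c = c"
    using A_bop a by (auto simp: c_def A_mult A_adj adj_compose subset_eq)
  have "r \<le> norm (adj a) * norm a"
    unfolding r_def c_def by (rule norm_blinfun_compose)
  also have "\<dots> \<le> norm a * norm a"
    using norm_adj_le[of a] a A_bop by (intro mult_right_mono) auto
  also have "\<dots> < 1"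
    using mult_strict_mono[OF lt lt] by simp
  finally have r: "0 \<le> r" "r < 1"
    by (simp_all add: r_def)
  \<comment> \<open>Self-adjointness is phrased through \<open>inner\<close>, where it is visibly a
    closed condition. The ball of radius \<open>r\<close> is preserved because (r + r^2) / 2 is at
    most \<open>r\<close>.\<close>
  define D where "D = {y \<in> A. norm y \<le> r \<and> (\<forall>u v. inner (blinfun_apply y u) v = inner u (blinfun_apply y v))}"
  define f where "f y = (1/2) *\<^sub>R (c + (y o\<^sub>L y))" for y
  have "closed D"
    unfolding D_def
    by (intro closed_Collect_conj closed_Collect_le closed_Collect_all closed_Collect_eq
        continuous_intros) (simp add: A_closed)
  have fD: "f ` D \<subseteq> D"
  proof safe
    fix y
    assume "y \<in> D"
    then have y: "y \<in> A" "norm y \<le> r"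
      "\<And>u v. inner (blinfun_apply y u) v = inner u (blinfun_apply y v)"
      by (auto simp: D_def)
    have "f y \<in> A"
      unfolding f_def scaleR_scaleC
      by (intro complex_vector.subspace_scale[OF sub] complex_vector.subspace_add[OF sub] c A_mult y)
    moreover have "norm (f y) \<le> (1/2) * (norm c + norm (y o\<^sub>L y))"
      by (simp add: f_def norm_triangle_ineq del: scaleR_add_right)
    then have "norm (f y) \<le> r"
      using order_trans[OF norm_blinfun_compose mult_mono[OF y(2) y(2)]] r
        mult_left_mono[of r 1 r] by (simp add: r_def)
    moreover have "inner (blinfun_apply c u) v = inner u (blinfun_apply c v)" for u v
      using inner_adj[of c u v] c A_bop by auto
    then have "inner (blinfun_apply (f y) u) v = inner u (blinfun_apply (f y) v)" for u v
      by (simp add: f_def y(3) blinfun.add_left blinfun.scaleR_left inner_add_left inner_add_right)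
    ultimately show "f y \<in> D"
      by (simp add: D_def)
  qed
  have con: "dist (f y) (f z) \<le> r * dist y z" if "y \<in> D \<and> z \<in> D" for y z
  proof -
    \<comment> \<open>This way of splitting y^2 - z^2 is valid although \<open>y\<close> and
      \<open>z\<close> need not commute.\<close>
    have "f y - f z = (1/2) *\<^sub>R ((y o\<^sub>L (y - z)) + ((y - z) o\<^sub>L z))"
      by (simp add: f_def comp.diff_left comp.diff_right algebra_simps)
    then have "norm (f y - f z) \<le> (1/2) * (norm (y o\<^sub>L (y - z)) + norm ((y - z) o\<^sub>L z))"
      by (simp add: norm_triangle_ineq del: scaleR_add_right)
    also have "\<dots> \<le> (1/2) * (r * norm (y - z) + norm (y - z) * r)"
      using that r
      by (intro mult_left_mono add_mono order_trans[OF norm_blinfun_compose] mult_mono) (auto simp: D_def)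
    finally show ?thesis by (simp add: dist_norm)
  qed
  have "0 \<in> D"
    using r by (simp add: D_def complex_vector.subspace_0[OF sub])
  have "\<exists>!y\<in>D. f y = y"
    by (rule Banach_fix[OF _ _ r fD con])
      (use \<open>closed D\<close> \<open>0 \<in> D\<close> in \<open>auto simp: complete_eq_closed\<close>)
  then obtain y where y: "y \<in> D" "f y = y" by blast
  \<comment> \<open>The fixed point equation, rewritten so that (1 - y)^2 = 1 - 2 y + y^2 becomes 1
    - c.\<close>
  have eq: "c + (y o\<^sub>L y) = 2 *\<^sub>R y"
    using arg_cong[OF y(2), of "\<lambda>z. 2 *\<^sub>R z"] by (simp add: f_def)
  have "y \<in> A" and "adj y = y"
    using y(1) A_bop by (auto simp: D_def intro: adj_eq_if_inner_adj)
  define b where "b = id_blinfun - y"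
  have "b \<in> A"
    unfolding b_def by (rule complex_vector.subspace_diff[OF sub id \<open>y \<in> A\<close>])
  moreover have "adj b = b"
    using A_bop \<open>y \<in> A\<close> \<open>adj y = y\<close>
    by (intro adj_eqI)
      (auto simp: b_def blinfun.diff_left cinner_diff_left cinner_diff_right cinner_adj)
  moreover have "b o\<^sub>L b = id_blinfun - (adj a o\<^sub>L a)"
  proof -
    have "b o\<^sub>L b = id_blinfun - 2 *\<^sub>R y + (y o\<^sub>L y)"
      by (rule blinfun_eqI)
        (simp add: b_def blinfun.diff_left blinfun.diff_right blinfun.add_left blinfun.scaleR_left
          scaleR_2)
    then show ?thesis
      by (simp add: c_def flip: eq)
  qed
  ultimately show ?thesis
    by (rule that)
qed

text \<open>With 1 = b* b + a* a in the algebra, applying \<open>\<omega>\<close> makes the squared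
  norms of the images of x under \<open>\<omega> b\<close> and \<open>\<omega> a\<close> add up to
  that of x.\<close>

lemma star_rep_norm_le_1:
  assumes A: "is_cstar_subalgebra A" and id: "id_blinfun \<in> A"
    and \<omega>: "star_rep A \<omega>" and a: "a \<in> A" and lt: "norm a < 1"
  shows "norm (\<omega> a) \<le> 1"
proof -
  obtain b where b: "b \<in> A" "adj b = b" "b o\<^sub>L b = id_blinfun - (adj a o\<^sub>L a)"
    using cstar_sqrt_one_minus[OF A id a lt] .
  have A_mult: "\<And>a b. a \<in> A \<Longrightarrow> b \<in> A \<Longrightarrow> a o\<^sub>L b \<in> A" and A_adj: "\<And>a. a \<in> A \<Longrightarrow> adj a \<in> A"
    using A by (auto simp: is_cstar_subalgebra_def)
  have \<omega>_bop: "\<And>a. a \<in> A \<Longrightarrow> \<omega> a \<in> bop UNIV UNIV"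
    and \<omega>_add: "\<And>a b. a \<in> A \<Longrightarrow> b \<in> A \<Longrightarrow> \<omega> (a + b) = \<omega> a + \<omega> b"
    and \<omega>_mult: "\<And>a b. a \<in> A \<Longrightarrow> b \<in> A \<Longrightarrow> \<omega> (a o\<^sub>L b) = \<omega> a o\<^sub>L \<omega> b"
    and \<omega>_adj: "\<And>a. a \<in> A \<Longrightarrow> \<omega> (adj a) = adj (\<omega> a)" and \<omega>_id: "\<omega> id_blinfun = id_blinfun"
    using \<omega> by (auto simp: star_rep_def clinear_on_def)
  have "id_blinfun = \<omega> ((b o\<^sub>L b) + (adj a o\<^sub>L a))"
    by (simp add: b \<omega>_id)
  also have "\<dots> = (\<omega> b o\<^sub>L \<omega> b) + (\<omega> (adj a) o\<^sub>L \<omega> a)"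
    using a b(1) by (simp only: A_mult A_adj \<omega>_add \<omega>_mult)
  also have "\<omega> b = adj (\<omega> b)"
    using \<omega>_adj[OF b(1)] b(2) by simp
  finally have "id_blinfun = (adj (\<omega> b) o\<^sub>L \<omega> b) + (adj (\<omega> a) o\<^sub>L \<omega> a)"
    using \<omega>_adj[OF a] \<omega>_adj[OF b(1)] b(2) by simp
  then have *: "x = blinfun_apply (adj (\<omega> b)) (blinfun_apply (\<omega> b) x)
      + blinfun_apply (adj (\<omega> a)) (blinfun_apply (\<omega> a) x)" for x
    by (metis blinfun.add_left blinfun_apply_blinfun_compose blinfun_apply_id_blinfun)
  have "norm (blinfun_apply (\<omega> a) x) \<le> 1 * norm x" for x
  proof -
    have "(norm x)\<^sup>2 = inner x (blinfun_apply (adj (\<omega> b)) (blinfun_apply (\<omega> b) x)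
      + blinfun_apply (adj (\<omega> a)) (blinfun_apply (\<omega> a) x))"
      by (simp add: power2_norm_eq_inner flip: *)
    also have "\<dots> = (norm (blinfun_apply (\<omega> b) x))\<^sup>2 + (norm (blinfun_apply (\<omega> a) x))\<^sup>2"
      by (simp add: inner_add_right power2_norm_eq_inner a b \<omega>_bop flip: inner_adj)
    finally have "(norm (blinfun_apply (\<omega> a) x))\<^sup>2 \<le> (norm x)\<^sup>2"
      by simp
    from power2_le_imp_le[OF this norm_ge_zero] show ?thesis
      by simp
  qed
  then show ?thesis
    by (intro norm_blinfun_bound) auto
qed

lemma star_rep_tendsto:
  assumes A: "is_cstar_subalgebra A" and id: "id_blinfun \<in> A" and \<omega>: "star_rep A \<omega>"
    and a: "\<And>n. a n \<in> A" "l \<in> A" "a \<longlonglongrightarrow> l"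
  shows "(\<lambda>n. \<omega> (a n)) \<longlonglongrightarrow> \<omega> l"
proof -
  have sub: "csubspace A"
    using A by (simp add: is_cstar_subalgebra_def)
  have clin: "clinear_on A \<omega>"
    using \<omega> by (simp add: star_rep_def)
  \<comment> \<open>Rescaling to norm 1/2 meets the strict bound \<open>norm a < 1\<close> of
    \<open>star_rep_norm_le_1\<close>; the resulting constant 2 is not sharp but gives
    continuity.\<close>
  have le: "norm (\<omega> x) \<le> 2 * norm x" if x: "x \<in> A" for x
  proof (cases "x = 0")
    case True
    have "\<omega> (0 *\<^sub>C x) = 0 *\<^sub>C \<omega> x"
      using clin x by (simp only: clinear_on_def)
    with True show ?thesis by simp
  next
    case False
    define y where "y = (1 / (2 * norm x)) *\<^sub>R x"
    have "norm y < 1"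
      using False by (simp add: y_def)
    moreover have "y \<in> A"
      unfolding y_def scaleR_scaleC by (rule complex_vector.subspace_scale[OF sub x])
    ultimately have "norm (\<omega> y) \<le> 1"
      by (intro star_rep_norm_le_1[OF A id \<omega>])
    moreover have "\<omega> y = (1 / (2 * norm x)) *\<^sub>R \<omega> x"
      using clin x unfolding y_def scaleR_scaleC by (simp add: clinear_on_def)
    ultimately show ?thesis
      using False by (simp add: field_simps)
  qed
  have "norm (\<omega> (a n) - \<omega> l) \<le> norm (a n - l) * 2" for n
  proof -
    have m: "a n - l \<in> A"
      by (intro complex_vector.subspace_diff[OF sub] a)
    have "\<omega> (a n - l + l) = \<omega> (a n - l) + \<omega> l"
      using clin m a by (simp only: clinear_on_def)
    with le[OF m] show ?thesis by simp
  qed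
  moreover have "(\<lambda>n. norm (a n - l) * 2) \<longlonglongrightarrow> 0"
    using a(3) by (simp add: LIM_zero tendsto_mult_left_zero tendsto_norm_zero)
  ultimately have "(\<lambda>n. \<omega> (a n) - \<omega> l) \<longlonglongrightarrow> 0"
    by (intro Lim_null_comparison[of "\<lambda>n. \<omega> (a n) - \<omega> l" "\<lambda>n. norm (a n - l) * 2"] always_eventually allI)
  then show ?thesis
    by (rule LIM_zero_cancel)
qed

text \<open>The elements whose images commute with \<open>R\<close> form a C*-subalgebra containing
  \<open>S\<close>: closure under adjoints uses that \<open>R\<close> is self-adjoint, norm closure
  uses continuity of \<open>\<omega>\<close>.\<close>

lemma star_rep_cstar_commute:
  assumes S: "S \<subseteq> bop UNIV UNIV" and id: "id_blinfun \<in> cstar S" and \<omega>: "star_rep (cstar S) \<omega>"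
    and R: "R \<in> bop UNIV UNIV" "adj R = R"
    and comm: "\<And>s. s \<in> S \<Longrightarrow> \<omega> s o\<^sub>L R = R o\<^sub>L \<omega> s"
    and a: "a \<in> cstar S"
  shows "\<omega> a o\<^sub>L R = R o\<^sub>L \<omega> a"
proof -
  have A: "is_cstar_subalgebra (cstar S)"
    using S by (rule is_cstar_subalgebra_cstar)
  then have A_bop: "cstar S \<subseteq> bop UNIV UNIV" and sub: "csubspace (cstar S)"
    and A_closed: "closed (cstar S)"
    and A_mult: "\<And>a b. a \<in> cstar S \<Longrightarrow> b \<in> cstar S \<Longrightarrow> a o\<^sub>L b \<in> cstar S"
    and A_adj: "\<And>a. a \<in> cstar S \<Longrightarrow> adj a \<in> cstar S"
    by (auto simp: is_cstar_subalgebra_def)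
  have \<omega>_bop: "\<And>a. a \<in> cstar S \<Longrightarrow> \<omega> a \<in> bop UNIV UNIV"
    and \<omega>_add: "\<And>a b. a \<in> cstar S \<Longrightarrow> b \<in> cstar S \<Longrightarrow> \<omega> (a + b) = \<omega> a + \<omega> b"
    and \<omega>_scale: "\<And>c a. a \<in> cstar S \<Longrightarrow> \<omega> (c *\<^sub>C a) = c *\<^sub>C \<omega> a"
    and \<omega>_mult: "\<And>a b. a \<in> cstar S \<Longrightarrow> b \<in> cstar S \<Longrightarrow> \<omega> (a o\<^sub>L b) = \<omega> a o\<^sub>L \<omega> b"
    and \<omega>_adj: "\<And>a. a \<in> cstar S \<Longrightarrow> \<omega> (adj a) = adj (\<omega> a)"
    using \<omega> by (auto simp: star_rep_def clinear_on_def)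
  define C where "C = {a \<in> cstar S. \<omega> a o\<^sub>L R = R o\<^sub>L \<omega> a}"
  have C_iff: "a \<in> C \<longleftrightarrow> a \<in> cstar S \<and>
      (\<forall>x. blinfun_apply (\<omega> a) (blinfun_apply R x) = blinfun_apply R (blinfun_apply (\<omega> a) x))" for a
    by (auto simp: C_def blinfun_eqI simp flip: blinfun_apply_blinfun_compose)
  have "is_cstar_subalgebra C"
    unfolding is_cstar_subalgebra_def
  proof (intro conjI ballI)
    have "\<omega> 0 = 0"
      using \<omega>_scale[OF id, of 0] by simp
    then show "csubspace C"
      by (intro complex_vector.subspaceI)
        (auto simp: C_iff complex_vector.subspace_0[OF sub] complex_vector.subspace_add[OF sub]
          complex_vector.subspace_scale[OF sub] \<omega>_add \<omega>_scale blinfun.add_left blinfun.add_right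
          scaleC_blinfun.rep_eq R)
    show "closed C"
      unfolding closed_sequential_limits
    proof (intro allI impI, elim conjE)
      fix f l
      assume f: "\<forall>n. f n \<in> C" and l: "f \<longlonglongrightarrow> l"
      then have fA: "\<And>n. f n \<in> cstar S"
        by (simp add: C_iff)
      with l A_closed have lA: "l \<in> cstar S"
        by (auto simp: closed_sequential_limits)
      have lim: "(\<lambda>n. \<omega> (f n)) \<longlonglongrightarrow> \<omega> l"
        by (rule star_rep_tendsto[OF A id \<omega> fA lA l])
      have "(\<lambda>n. \<omega> (f n) o\<^sub>L R) \<longlonglongrightarrow> (\<omega> l o\<^sub>L R)" "(\<lambda>n. R o\<^sub>L \<omega> (f n)) \<longlonglongrightarrow> (R o\<^sub>L \<omega> l)"
        by (intro bounded_bilinear.tendsto[OF bounded_bilinear_blinfun_compose] lim tendsto_const)+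
      moreover have "(\<lambda>n. \<omega> (f n) o\<^sub>L R) = (\<lambda>n. R o\<^sub>L \<omega> (f n))"
        using f by (auto simp: C_def)
      ultimately have "\<omega> l o\<^sub>L R = R o\<^sub>L \<omega> l"
        by (metis LIMSEQ_unique)
      with lA show "l \<in> C"
        by (simp add: C_def)
    qed
    show "adj a \<in> C" if "a \<in> C" for a
    proof -
      have "adj (\<omega> a o\<^sub>L R) = adj (R o\<^sub>L \<omega> a)" "a \<in> cstar S"
        using that by (auto simp: C_def)
      then show ?thesis
        by (simp add: C_def adj_compose \<omega>_bop R A_adj \<omega>_adj)
    qed
  qed (use A_bop in \<open>auto simp: C_iff A_mult \<omega>_mult\<close>)
  moreover have "S \<subseteq> C"
    using comm hull_subset[of S is_cstar_subalgebra] by (auto simp: C_def cstar_def)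
  ultimately have "cstar S \<subseteq> C"
    unfolding cstar_def[of S] by (rule hull_minimal[rotated])
  with a show ?thesis
    by (auto simp: C_def)
qed

section \<open>Corners\<close>

lemma bop_subset_bop_UNIV: "bop H K \<subseteq> bop UNIV UNIV"
proof
  fix A :: "'a \<Rightarrow>\<^sub>L 'b"
  assume "A \<in> bop H K"
  then have "\<forall>c x. blinfun_apply A (c *\<^sub>C x) = c *\<^sub>C blinfun_apply A x"
    unfolding bop_def by blast
  then show "A \<in> bop UNIV UNIV"
    unfolding bop_UNIV_iff .
qed

lemma projection_onD:
  assumes "projection_on H p"
  shows "p \<in> bop UNIV UNIV" "p o\<^sub>L p = p" "adj p = p"
  using assms bop_subset_bop_UNIV unfolding projection_on_def by blast+

text \<open>Replaces orthogonality by the equations p A = A = A q. In one direction x - q x is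
  orthogonal to the range of \<open>q\<close>; in the other, a vector orthogonal to that range is
  killed by \<open>q\<close>.\<close>

lemma bop_range_iff:
  assumes p: "projection_on UNIV p" and q: "projection_on UNIV q"
  shows "A \<in> bop (range (blinfun_apply q)) (range (blinfun_apply p)) \<longleftrightarrow>
    A \<in> bop UNIV UNIV \<and> (\<forall>x. blinfun_apply p (blinfun_apply A x) = blinfun_apply A x) \<and>
    (\<forall>x. blinfun_apply A (blinfun_apply q x) = blinfun_apply A x)"
    (is "?L \<longleftrightarrow> ?R")
proof -
  have pp: "blinfun_apply p (blinfun_apply p x) = blinfun_apply p x" for x
    using projection_onD(2)[OF p] by (metis blinfun_apply_blinfun_compose)
  have qq: "blinfun_apply q (blinfun_apply q x) = blinfun_apply q x" for x
    using projection_onD(2)[OF q] by (metis blinfun_apply_blinfun_compose)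
  have q_adj: "cinner x (blinfun_apply q y) = cinner (blinfun_apply q x) y" for x y
    using projection_onD[OF q] by (simp add: cinner_adj)
  show ?thesis
  proof
    assume L: ?L
    have "blinfun_apply A (x - blinfun_apply q x) = 0" for x
    proof -
      have "cinner (x - blinfun_apply q x) (blinfun_apply q y) = 0" for y
        by (simp add: q_adj qq blinfun.diff_right cinner_diff_left)
      with L show ?thesis unfolding bop_def by blast
    qed
    then have "\<forall>x. blinfun_apply A (blinfun_apply q x) = blinfun_apply A x"
      by (simp add: blinfun.diff_right)
    moreover have "\<forall>x. blinfun_apply A x \<in> range (blinfun_apply p)"
      using L unfolding bop_def by blast
    then have "\<forall>x. blinfun_apply p (blinfun_apply A x) = blinfun_apply A x"
      by (metis pp rangeE)
    ultimately show ?R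
      using L bop_subset_bop_UNIV by blast
  next
    assume R: ?R
    have "blinfun_apply A x = 0" if "\<forall>h\<in>range (blinfun_apply q). cinner x h = 0" for x
    proof -
      have "cinner (blinfun_apply q x) (blinfun_apply q x) = 0"
        using that by (simp add: q_adj[symmetric] qq)
      then have "blinfun_apply q x = 0"
        by (metis cinner_eq_inner complex.sel(1) inner_eq_zero_iff zero_complex.sel(1))
      with R show ?thesis by (metis blinfun.zero_right)
    qed
    moreover have "blinfun_apply A x \<in> range (blinfun_apply p)" for x
      using R by (metis rangeI)
    moreover have "\<forall>c x. blinfun_apply A (c *\<^sub>C x) = c *\<^sub>C blinfun_apply A x"
      using R by (simp add: bop_UNIV_iff)
    ultimately show ?L
      unfolding bop_def by blast
  qed
qed

text \<open>The range of an idempotent is its set of fixed points, which is closed by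
  continuity.\<close>

lemma closed_csubspace_range:
  assumes "projection_on UNIV p"
  shows "closed_csubspace (range (blinfun_apply p))"
proof -
  have pp: "blinfun_apply p (blinfun_apply p x) = blinfun_apply p x" for x
    using projection_onD(2)[OF assms] by (metis blinfun_apply_blinfun_compose)
  then have "range (blinfun_apply p) = {x. blinfun_apply p x = x}"
    by (auto simp: image_iff) metis
  moreover have "closed {x. blinfun_apply p x = x}"
    by (intro closed_Collect_eq continuous_intros)
  moreover have "csubspace {x. blinfun_apply p x = x}"
    using projection_onD(1)[OF assms]
    by (auto intro!: complex_vector.subspaceI simp: blinfun.add_right)
  ultimately show ?thesis
    by (simp add: closed_csubspace_def)
qed

section \<open>Two by two operator matrices and the corner embedding\<close>

lemma block_op_in_bop [simp]:
  "a \<in> bop UNIV UNIV \<Longrightarrow> b \<in> bop UNIV UNIV \<Longrightarrow> c \<in> bop UNIV UNIV \<Longrightarrow> d \<in> bop UNIV UNIV \<Longrightarrow>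
    block_op a b c d \<in> bop UNIV UNIV"
  by (simp add: bop_UNIV_iff block_op.rep_eq scaleC_prod_def scaleC_add_right)

lemma block_op_compose:
  "block_op a b c d o\<^sub>L block_op a' b' c' d' =
    block_op ((a o\<^sub>L a') + (b o\<^sub>L c')) ((a o\<^sub>L b') + (b o\<^sub>L d'))
      ((c o\<^sub>L a') + (d o\<^sub>L c')) ((c o\<^sub>L b') + (d o\<^sub>L d'))"
  by (rule blinfun_eqI) (simp add: block_op.rep_eq blinfun.add_left blinfun.add_right)

lemma adj_block_op:
  "a \<in> bop UNIV UNIV \<Longrightarrow> b \<in> bop UNIV UNIV \<Longrightarrow> c \<in> bop UNIV UNIV \<Longrightarrow> d \<in> bop UNIV UNIV \<Longrightarrow>
    adj (block_op a b c d) = block_op (adj a) (adj c) (adj b) (adj d)"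
  by (rule adj_eqI)
    (simp add: block_op.rep_eq cinner_prod_def cinner_add_left cinner_add_right cinner_adj)

lemma blinfun_compose_id [simp]: "id_blinfun o\<^sub>L A = A" "A o\<^sub>L id_blinfun = A"
  by (rule blinfun_eqI; simp)+

abbreviation corner ::
  "('h::complex_hilbert \<Rightarrow>\<^sub>L 'k::complex_hilbert) \<Rightarrow> (('k \<times> 'h) \<Rightarrow>\<^sub>L ('k \<times> 'h))"
  where "corner t \<equiv> block_op 0 t 0 0"

lemma corner_0: "corner 0 = 0"
  by (rule blinfun_eqI) (simp add: block_op.rep_eq zero_prod_def)

lemma corner_add: "corner (s + t) = corner s + corner t"
  by (rule blinfun_eqI) (simp add: block_op.rep_eq blinfun.add_left)

lemma corner_scaleC: "corner (c *\<^sub>C s) = c *\<^sub>C corner s"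
  by (rule blinfun_eqI) (simp add: block_op.rep_eq scaleC_blinfun.rep_eq scaleC_prod_def)

text \<open>The lower left entry is the adjoint of a corner, so a *-representation is known on the
  Paulsen system from its values on corners and diagonal units. The bracketing follows
  \<open>restricts_to_paulsen_map\<close>.\<close>

lemma paulsen_elem_eq:
  assumes "y \<in> bop UNIV UNIV"
  shows "paulsen_elem l x y m =
    (l *\<^sub>C block_op id_blinfun 0 0 0 + corner x) + (adj (corner y) + m *\<^sub>C block_op 0 0 0 id_blinfun)"
  by (rule blinfun_eqI)
    (simp add: paulsen_elem_def adj_block_op assms block_op.rep_eq blinfun.add_left
      scaleC_blinfun.rep_eq scaleC_prod_def)

text \<open>Two corners multiply to 0, but inserting an adjoint between them returns to the right
  summand, so the ternary product is inherited from the algebra.\<close>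

lemma corner_triple:
  assumes "y \<in> bop UNIV UNIV"
  shows "corner (x o\<^sub>L adj y o\<^sub>L z) = corner x o\<^sub>L adj (corner y) o\<^sub>L corner z"
  by (simp add: adj_block_op assms block_op_compose)

lemma tendsto_corner:
  assumes "a \<longlonglongrightarrow> l"
  shows "(\<lambda>n. corner (a n)) \<longlonglongrightarrow> corner l"
proof -
  have "norm (corner (a n) - corner l) \<le> norm (a n - l)" for n
  proof (rule norm_blinfun_bound)
    fix x
    have "norm (blinfun_apply (corner (a n) - corner l) x) = norm (blinfun_apply (a n - l) (snd x))"
      by (simp add: blinfun.diff_left block_op.rep_eq norm_Pair)
    also have "\<dots> \<le> norm (a n - l) * norm x"
      using norm_snd_le[of "snd x" "fst x"]
      by (intro order_trans[OF norm_blinfun] mult_left_mono) simp_all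
    finally show "norm (blinfun_apply (corner (a n) - corner l) x) \<le> norm (a n - l) * norm x" .
  qed simp
  moreover have "(\<lambda>n. norm (a n - l)) \<longlonglongrightarrow> 0"
    using assms by (simp add: LIM_zero tendsto_norm_zero)
  ultimately have "(\<lambda>n. corner (a n) - corner l) \<longlonglongrightarrow> 0"
    by (intro Lim_null_comparison[of "\<lambda>n. corner (a n) - corner l" "\<lambda>n. norm (a n - l)"] always_eventually allI)
  then show ?thesis
    by (rule LIM_zero_cancel)
qed

text \<open>The operators whose corner lies in \<open>A\<close> form a TRO, by linearity and
  continuity of the embedding and \<open>corner_triple\<close>; minimality of the hull does the
  rest.\<close>

lemma corner_tro_hull:
  assumes A: "is_cstar_subalgebra A" and X: "operator_space X" "\<And>x. x \<in> X \<Longrightarrow> corner x \<in> A"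
    and t: "t \<in> is_tro hull X"
  shows "t \<in> bop UNIV UNIV" "corner t \<in> A"
proof -
  have sub: "csubspace A" and A_closed: "closed A"
    and A_mult: "\<And>a b. a \<in> A \<Longrightarrow> b \<in> A \<Longrightarrow> a o\<^sub>L b \<in> A" and A_adj: "\<And>a. a \<in> A \<Longrightarrow> adj a \<in> A"
    using A by (auto simp: is_cstar_subalgebra_def)
  define B where "B = {t \<in> bop UNIV UNIV. corner t \<in> A}"
  have "is_tro B"
    unfolding is_tro_def operator_space_def
  proof (intro conjI ballI)
    show "csubspace B"
      by (intro complex_vector.subspaceI)
        (auto simp: B_def corner_0 corner_add corner_scaleC complex_vector.subspace_0[OF sub]
          complex_vector.subspace_add[OF sub] complex_vector.subspace_scale[OF sub])
    show "closed B"
      unfolding closed_sequential_limits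
    proof (intro allI impI, elim conjE)
      fix f l
      assume f: "\<forall>n. f n \<in> B" and l: "f \<longlonglongrightarrow> l"
      have "l \<in> bop UNIV UNIV"
        using f l closed_bop_UNIV unfolding closed_sequential_limits B_def by blast
      moreover have "corner l \<in> A"
        by (rule closed_sequentially[OF A_closed _ tendsto_corner[OF l]]) (use f in \<open>simp add: B_def\<close>)
      ultimately show "l \<in> B"
        by (simp add: B_def)
    qed
  qed (auto simp: B_def corner_triple A_mult A_adj)
  moreover have "X \<subseteq> B"
    using X by (auto simp: B_def operator_space_def)
  ultimately have "is_tro hull X \<subseteq> B"
    by (rule hull_minimal[rotated])
  with t show "t \<in> bop UNIV UNIV" "corner t \<in> A"
    by (auto simp: B_def)
qed

section \<open>Decomposing a weak boundary representation of the Paulsen system\<close>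

theorem proposition4p2:
  fixes X T :: "('h::complex_hilbert \<Rightarrow>\<^sub>L 'k::complex_hilbert) set"
    and \<omega> :: "(('k \<times> 'h) \<Rightarrow>\<^sub>L ('k \<times> 'h)) \<Rightarrow> ('l::complex_hilbert \<Rightarrow>\<^sub>L 'l)"
  assumes "operator_space X"
    and "T = is_tro hull X"
    and "weak_boundary_star_rep (paulsen_system X) \<omega>"
  shows "\<exists>K H \<theta>. orthogonal_decomposition K H \<and> weak_boundary_triple X T H K \<theta> \<and>
    restricts_to_paulsen_map X K H \<theta> \<omega>"
proof -
  define S where "S = paulsen_system X"
  define P :: "('k \<times> 'h) \<Rightarrow>\<^sub>L ('k \<times> 'h)" where "P = block_op id_blinfun 0 0 0"
  define Q :: "('k \<times> 'h) \<Rightarrow>\<^sub>L ('k \<times> 'h)" where "Q = block_op 0 0 0 id_blinfun"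
  define p where "p = \<omega> P"
  define q where "q = \<omega> Q"
  define \<theta> where "\<theta> t = \<omega> (corner t)" for t
  have X_bop: "\<And>x. x \<in> X \<Longrightarrow> x \<in> bop UNIV UNIV" and X0: "0 \<in> X"
    using assms(1) by (auto simp: operator_space_def complex_vector.subspace_0)
  have S_bop: "S \<subseteq> bop UNIV UNIV"
    by (auto simp: S_def paulsen_system_def paulsen_elem_def X_bop)
  have A: "is_cstar_subalgebra (cstar S)"
    using S_bop by (rule is_cstar_subalgebra_cstar)
  then have sub: "csubspace (cstar S)"
    and A_mult: "\<And>a b. a \<in> cstar S \<Longrightarrow> b \<in> cstar S \<Longrightarrow> a o\<^sub>L b \<in> cstar S"
    and A_adj: "\<And>a. a \<in> cstar S \<Longrightarrow> adj a \<in> cstar S"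
    by (auto simp: is_cstar_subalgebra_def)
  note A_add = complex_vector.subspace_add[OF sub] and A_scale = complex_vector.subspace_scale[OF sub]
  have irr: "irreducible_star_rep (cstar S) \<omega>"
    and bdry: "\<And>V a. isometry_on UNIV V \<Longrightarrow> (\<And>s. s \<in> S \<Longrightarrow> adj V o\<^sub>L \<omega> s o\<^sub>L V = \<omega> s) \<Longrightarrow>
      a \<in> cstar S \<Longrightarrow> adj V o\<^sub>L \<omega> a o\<^sub>L V = \<omega> a"
    using assms(3) by (auto simp: weak_boundary_star_rep_def S_def)
  then have \<omega>: "star_rep (cstar S) \<omega>"
    by (simp add: irreducible_star_rep_def)
  then have \<omega>_bop [simp]: "\<And>a. a \<in> cstar S \<Longrightarrow> \<omega> a \<in> bop UNIV UNIV"
    and \<omega>_add: "\<And>a b. a \<in> cstar S \<Longrightarrow> b \<in> cstar S \<Longrightarrow> \<omega> (a + b) = \<omega> a + \<omega> b"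
    and \<omega>_scale: "\<And>c a. a \<in> cstar S \<Longrightarrow> \<omega> (c *\<^sub>C a) = c *\<^sub>C \<omega> a"
    and \<omega>_mult: "\<And>a b. a \<in> cstar S \<Longrightarrow> b \<in> cstar S \<Longrightarrow> \<omega> (a o\<^sub>L b) = \<omega> a o\<^sub>L \<omega> b"
    and \<omega>_adj: "\<And>a. a \<in> cstar S \<Longrightarrow> \<omega> (adj a) = adj (\<omega> a)"
    and \<omega>_id: "\<omega> id_blinfun = id_blinfun"
    by (auto simp: star_rep_def clinear_on_def)
  have elem: "paulsen_elem l x y m \<in> cstar S" if "x \<in> X" "y \<in> X" for l x y m
    unfolding cstar_def using that by (auto simp: S_def paulsen_system_def intro!: hull_inc)
  \<comment> \<open>As 0 lies in \<open>X\<close>, the diagonal units are Paulsen elements with zero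
    off-diagonal entries.\<close>
  have PA: "P \<in> cstar S"
    using elem[OF X0 X0, of 1 0] by (simp add: P_def paulsen_elem_def)
  have QA: "Q \<in> cstar S"
    using elem[OF X0 X0, of 0 1] by (simp add: Q_def paulsen_elem_def)
  have cornerA: "corner x \<in> cstar S" if "x \<in> X" for x
    using elem[OF that X0, of 0 0] by (simp add: paulsen_elem_def)
  have T_bop: "t \<in> bop UNIV UNIV" and TA: "corner t \<in> cstar S" if "t \<in> T" for t
    using corner_tro_hull[OF A assms(1) cornerA] that assms(2) by auto
  have XT: "X \<subseteq> T"
    unfolding assms(2) by (rule hull_subset)
  have PQ: "P + Q = id_blinfun"
    by (rule blinfun_eqI) (simp add: P_def Q_def block_op.rep_eq blinfun.add_left)
  \<comment> \<open>\<open>cstar\<close> does not ask for a unit; here it comes from the diagonal of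
    the Paulsen system.\<close>
  have id: "id_blinfun \<in> cstar S"
    unfolding PQ[symmetric] using PA QA by (rule A_add)
  have pq: "p + q = id_blinfun"
    using \<omega>_add[OF PA QA] by (simp add: PQ \<omega>_id p_def q_def)
  have p: "projection_on UNIV p" and q: "projection_on UNIV q"
    using PA QA \<omega>_mult[OF PA PA] \<omega>_mult[OF QA QA] \<omega>_adj[OF PA] \<omega>_adj[OF QA]
    by (simp_all add: projection_on_def p_def q_def P_def Q_def block_op_compose adj_block_op)
  note p' [simp] = projection_onD[OF p] and q' [simp] = projection_onD[OF q]
  have pp [simp]: "blinfun_apply p (blinfun_apply p x) = blinfun_apply p x"
    and qq [simp]: "blinfun_apply q (blinfun_apply q x) = blinfun_apply q x" for x
    using p'(2) q'(2) by (metis blinfun_apply_blinfun_compose)+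
  have sum: "blinfun_apply p x + blinfun_apply q x = x" for x
    using pq by (metis blinfun.add_left blinfun_apply_id_blinfun)
  \<comment> \<open>Decomposing \<open>p x\<close> itself by \<open>sum\<close> leaves no room for a
    component in the range of \<open>q\<close>.\<close>
  have qp0 [simp]: "blinfun_apply q (blinfun_apply p x) = 0"
    and pq0 [simp]: "blinfun_apply p (blinfun_apply q x) = 0" for x
    using sum[of "blinfun_apply p x"] sum[of "blinfun_apply q x"] by simp_all
  define K where "K = range (blinfun_apply p)"
  define H where "H = range (blinfun_apply q)"
  have orth: "inner (blinfun_apply q x) (blinfun_apply p y) = 0" for x y
    using inner_adj[OF q'(1), of x "blinfun_apply p y"] by simp
  have corth: "cinner (blinfun_apply p x) (blinfun_apply q y) = 0" for x y
    using cinner_adj[OF p'(1), of x "blinfun_apply q y"] by simp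
  note bop_HK = bop_range_iff[OF p q, folded H_def K_def]
    and bop_HH = bop_range_iff[OF q q, folded H_def]
    and bop_KK = bop_range_iff[OF p p, folded K_def]
    and bop_KH = bop_range_iff[OF q p, folded H_def K_def]
  \<comment> \<open>Adjoints of e B = B = B f exchange the two supports; this is applied to
    \<open>\<theta> y\<close>, \<open>u\<close> and \<open>v\<close>.\<close>
  have adj_bop_range: "adj B \<in> bop (range (blinfun_apply e)) (range (blinfun_apply f))"
    if "B \<in> bop (range (blinfun_apply f)) (range (blinfun_apply e))"
      "projection_on UNIV e" "projection_on UNIV f"
    for B e f :: "'l \<Rightarrow>\<^sub>L 'l"
  proof -
    note e = projection_onD[OF that(2)] and f = projection_onD[OF that(3)]
    have B: "B \<in> bop UNIV UNIV" "e o\<^sub>L B = B" "B o\<^sub>L f = B"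
      using that(1) by (auto simp: bop_range_iff[OF that(2,3)] intro: blinfun_eqI)
    have "adj B o\<^sub>L e = adj B" "f o\<^sub>L adj B = adj B"
      using adj_compose[OF e(1) B(1)] adj_compose[OF B(1) f(1)] e(3) f(3) B(2,3) by simp_all
    with B(1) show ?thesis
      by (simp add: bop_range_iff[OF that(3,2)] flip: blinfun_apply_blinfun_compose)
  qed
  note adj_HK = adj_bop_range[OF _ p q, folded H_def K_def]
    and adj_HH = adj_bop_range[OF _ q q, folded H_def]
    and adj_KK = adj_bop_range[OF _ p p, folded K_def]
  have \<theta>_bop: "\<theta> t \<in> bop H K" if "t \<in> T" for t
  proof -
    have "P o\<^sub>L corner t = corner t" "corner t o\<^sub>L Q = corner t"
      by (simp_all add: P_def Q_def block_op_compose)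
    then have "p o\<^sub>L \<theta> t = \<theta> t" "\<theta> t o\<^sub>L q = \<theta> t"
      using \<omega>_mult[OF PA TA[OF that]] \<omega>_mult[OF TA[OF that] QA] by (simp_all add: \<theta>_def p_def q_def)
    then show ?thesis
      using TA[OF that] by (simp add: bop_HK \<theta>_def flip: blinfun_apply_blinfun_compose)
  qed
  \<comment> \<open>Through this formula every later identity on the Paulsen system splits into one
    check per matrix entry.\<close>
  have \<omega>_elem: "\<omega> (paulsen_elem l x y m) = (l *\<^sub>C p + \<theta> x) + (adj (\<theta> y) + m *\<^sub>C q)"
    if "x \<in> X" "y \<in> X" for l x y m
    using that cornerA PA QA
    by (simp add: paulsen_elem_eq[OF X_bop] \<omega>_add \<omega>_scale \<omega>_adj A_add A_scale A_adj p_def q_def \<theta>_def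
        flip: P_def Q_def)
  \<comment> \<open>B C = B e f C = 0 when \<open>B\<close> is supported on \<open>e\<close>,
    \<open>C\<close> has range in \<open>f\<close>, and e f = 0; used with \<open>p\<close> and
    \<open>q\<close> in either order.\<close>
  have comp0: "blinfun_apply B (blinfun_apply C x) = 0"
    if "\<And>x. blinfun_apply B (blinfun_apply e x) = blinfun_apply B x"
      "\<And>x. blinfun_apply f (blinfun_apply C x) = blinfun_apply C x"
      "\<And>x. blinfun_apply e (blinfun_apply f x) = 0" for B C e f :: "'l \<Rightarrow>\<^sub>L 'l" and x
    using that by (metis blinfun.zero_right)

  have od: "orthogonal_decomposition K H"
    unfolding orthogonal_decomposition_def
    using closed_csubspace_range[OF p] closed_csubspace_range[OF q] corth sum
    by (auto simp: K_def H_def) metis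

  have rm: "restricts_to_paulsen_map X K H \<theta> \<omega>"
    unfolding restricts_to_paulsen_map_def
  proof (intro allI ballI)
    fix l m x y k h
    assume x: "x \<in> X" and y: "y \<in> X" and k: "k \<in> K" and h: "h \<in> H"
    have k': "blinfun_apply p k = k" "blinfun_apply q k = 0"
      and h': "blinfun_apply p h = 0" "blinfun_apply q h = h"
      using k h by (auto simp: K_def H_def)
    have \<theta>x: "\<theta> x \<in> bop H K" and \<theta>y: "adj (\<theta> y) \<in> bop K H"
      using x y XT by (auto intro!: \<theta>_bop adj_HK)
    \<comment> \<open>Each off-diagonal entry sees only one summand of \<open>k + h\<close>, which
      is exactly the matrix action.\<close>
    have "blinfun_apply (\<theta> x) k = 0"
      using \<theta>x k'(2) by (metis bop_HK blinfun.zero_right)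
    moreover have "blinfun_apply (adj (\<theta> y)) h = 0"
      using \<theta>y h'(1) by (metis bop_KH blinfun.zero_right)
    ultimately show "blinfun_apply (\<omega> (paulsen_elem l x y m)) (k + h) =
        (l *\<^sub>C k + blinfun_apply (\<theta> x) h) + (blinfun_apply (adj (\<theta> y)) k + m *\<^sub>C h)"
      by (simp add: \<omega>_elem[OF x y] blinfun.add_left blinfun.add_right scaleC_blinfun.rep_eq k' h')
  qed

  have tm: "triple_morphism T H K \<theta>"
    unfolding triple_morphism_def
  proof (intro conjI ballI)
    show "closed_csubspace H" "closed_csubspace K"
      unfolding H_def K_def using p q by (intro closed_csubspace_range; simp)+
    show "\<theta> ` T \<subseteq> bop H K"
      using \<theta>_bop by auto
    show "clinear_on T \<theta>"
      by (simp add: corner_add corner_scaleC clinear_on_def \<theta>_def \<omega>_add \<omega>_scale TA)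
    show "\<theta> (x o\<^sub>L adj y o\<^sub>L z) = \<theta> x o\<^sub>L adj (\<theta> y) o\<^sub>L \<theta> z" if "x \<in> T" "y \<in> T" "z \<in> T" for x y z
      using that by (simp add: \<theta>_def corner_triple T_bop TA A_mult A_adj \<omega>_mult \<omega>_adj)
  qed

  have ir: "(r = 0 \<and> s = 0) \<or> ((\<forall>h\<in>H. blinfun_apply r h = h) \<and> (\<forall>k\<in>K. blinfun_apply s k = k))"
    if r: "projection_on H r" and s: "projection_on K s" and rs: "\<forall>t\<in>T. s o\<^sub>L \<theta> t = \<theta> t o\<^sub>L r"
    for r s
  proof -
    note r' = projection_onD[OF r] and s' = projection_onD[OF s]
    have rH: "r \<in> bop H H" and sK: "s \<in> bop K K"
      using r s by (auto simp: projection_on_def)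
    note [simp] = rH[unfolded bop_HH, THEN conjunct2, THEN conjunct1, rule_format]
      rH[unfolded bop_HH, THEN conjunct2, THEN conjunct2, rule_format]
      sK[unfolded bop_KK, THEN conjunct2, THEN conjunct1, rule_format]
      sK[unfolded bop_KK, THEN conjunct2, THEN conjunct2, rule_format]
    \<comment> \<open>Since \<open>r\<close> lives on \<open>H\<close> and \<open>s\<close> on
      \<open>K\<close>, all mixed products vanish. Hence r + s is idempotent and commutes with
      \<open>p\<close> and \<open>q\<close>.\<close>
    have [simp]: "blinfun_apply p (blinfun_apply r x) = 0" "blinfun_apply r (blinfun_apply p x) = 0"
      "blinfun_apply q (blinfun_apply s x) = 0" "blinfun_apply s (blinfun_apply q x) = 0"
      "blinfun_apply r (blinfun_apply s x) = 0" "blinfun_apply s (blinfun_apply r x) = 0" for x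
      by (rule comp0[of _ p q] comp0[of _ q p]; simp)+
    have [simp]: "blinfun_apply r (blinfun_apply r x) = blinfun_apply r x"
      "blinfun_apply s (blinfun_apply s x) = blinfun_apply s x" for x
      using r'(2) s'(2) by (metis blinfun_apply_blinfun_compose)+
    define R where "R = r + s"
    have R: "R \<in> bop UNIV UNIV" "adj R = R"
      using r' s' by (simp_all add: R_def adj_add)
    have RR: "R o\<^sub>L R = R"
      by (rule blinfun_eqI) (simp add: R_def blinfun.add_left blinfun.add_right)
    have R\<theta>: "\<theta> t o\<^sub>L R = R o\<^sub>L \<theta> t" if "t \<in> T" for t
    proof (rule blinfun_eqI)
      fix x
      note \<theta>t = \<theta>_bop[OF that, unfolded bop_HK]
      have "blinfun_apply (\<theta> t) (blinfun_apply s x) = 0"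
        by (rule comp0[of _ q p]) (use \<theta>t in simp_all)
      moreover have "blinfun_apply r (blinfun_apply (\<theta> t) x) = 0"
        by (rule comp0[of _ q p]) (use \<theta>t in simp_all)
      moreover have "blinfun_apply s (blinfun_apply (\<theta> t) x) = blinfun_apply (\<theta> t) (blinfun_apply r x)"
        using rs that by (metis blinfun_apply_blinfun_compose)
      ultimately show "blinfun_apply (\<theta> t o\<^sub>L R) x = blinfun_apply (R o\<^sub>L \<theta> t) x"
        by (simp add: R_def blinfun.add_left blinfun.add_right)
    qed
    \<comment> \<open>Adjoints of the previous relation, as \<open>R\<close> is self-adjoint; needed
      for the lower left entries.\<close>
    have R\<theta>': "adj (\<theta> t) o\<^sub>L R = R o\<^sub>L adj (\<theta> t)" if "t \<in> T" for t
      using arg_cong[OF R\<theta>[OF that], of adj] \<theta>_bop[OF that] by (simp add: adj_compose R bop_HK)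
    have "\<omega> a o\<^sub>L R = R o\<^sub>L \<omega> a" if "a \<in> cstar S" for a
      using S_bop id \<omega> R _ that
    proof (rule star_rep_cstar_commute)
      fix a
      assume "a \<in> S"
      then obtain l x y m where a: "a = paulsen_elem l x y m" and xy: "x \<in> X" "y \<in> X"
        by (auto simp: S_def paulsen_system_def)
      with XT have "x \<in> T" "y \<in> T" by auto
      from R\<theta>[OF this(1)] R\<theta>'[OF this(2)]
      have *: "blinfun_apply (\<theta> x) (blinfun_apply R z) = blinfun_apply R (blinfun_apply (\<theta> x) z)"
        "blinfun_apply (adj (\<theta> y)) (blinfun_apply R z) = blinfun_apply R (blinfun_apply (adj (\<theta> y)) z)" for z
        by (metis blinfun_apply_blinfun_compose)+
      have **: "blinfun_apply p (blinfun_apply R z) = blinfun_apply R (blinfun_apply p z)"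
        "blinfun_apply q (blinfun_apply R z) = blinfun_apply R (blinfun_apply q z)" for z
        by (simp_all add: R_def blinfun.add_left blinfun.add_right)
      show "\<omega> a o\<^sub>L R = R o\<^sub>L \<omega> a"
        by (rule blinfun_eqI)
          (simp add: a \<omega>_elem[OF xy] blinfun.add_left blinfun.add_right scaleC_blinfun.rep_eq R * **)
    qed
    \<comment> \<open>Irreducibility of \<open>\<omega>\<close> is stated by invariant subspaces, so
      the projection \<open>R\<close> enters through its range.\<close>
    then have "blinfun_apply (\<omega> a) (blinfun_apply R x) \<in> range (blinfun_apply R)" if "a \<in> cstar S" for a x
      using that by (metis blinfun_apply_blinfun_compose rangeI)
    moreover have "closed_csubspace (range (blinfun_apply R))"
      by (rule closed_csubspace_range) (simp add: projection_on_def R RR)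
    ultimately have "range (blinfun_apply R) = {0} \<or> range (blinfun_apply R) = UNIV"
      using irr by (auto simp: irreducible_star_rep_def)
    then show ?thesis
    proof
      assume "range (blinfun_apply R) = {0}"
      then have R0: "blinfun_apply R x = 0" for x by auto
      \<comment> \<open>Evaluating \<open>R\<close> at \<open>q x\<close> isolates
        \<open>r x\<close>, and at \<open>p x\<close> it isolates \<open>s x\<close>.\<close>
      have "blinfun_apply r x = 0" "blinfun_apply s x = 0" for x
        using R0[of "blinfun_apply q x"] R0[of "blinfun_apply p x"]
        by (simp_all add: R_def blinfun.add_left)
      then show ?thesis by (simp add: blinfun_eqI)
    next
      assume "range (blinfun_apply R) = UNIV"
      then have R1: "blinfun_apply R x = x" for x
        using RR by (metis blinfun_apply_blinfun_compose rangeE UNIV_I)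
      have "blinfun_apply r (blinfun_apply q x) = blinfun_apply q x"
        "blinfun_apply s (blinfun_apply p x) = blinfun_apply p x" for x
        using R1[of "blinfun_apply q x"] R1[of "blinfun_apply p x"]
        by (simp_all add: R_def blinfun.add_left)
      then show ?thesis by (auto simp: H_def K_def)
    qed
  qed

  have bd: "adj v o\<^sub>L \<theta> t o\<^sub>L u = \<theta> t"
    if u: "isometry_on H u" and v: "isometry_on K v"
      and uv: "\<forall>x\<in>X. adj v o\<^sub>L \<theta> x o\<^sub>L u = \<theta> x" and t: "t \<in> T" for u v t
  proof -
    have uH: "u \<in> bop H H" and vK: "v \<in> bop K K"
      using u v by (auto simp: isometry_on_def)
    note u' = uH[unfolded bop_HH] adj_HH[OF uH, unfolded bop_HH]
      and v' = vK[unfolded bop_KK] adj_KK[OF vK, unfolded bop_KK]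
    \<comment> \<open>As u = u q and \<open>u\<close> is isometric on \<open>H\<close>, the
      operators \<open>u\<close> and \<open>q\<close> give equal norms everywhere; polarisation
      upgrades this to u* u = q.\<close>
    have norm_u: "norm (blinfun_apply u x) = norm (blinfun_apply q x)" for x
      using u u' unfolding isometry_on_def H_def by (metis rangeI)
    have norm_v: "norm (blinfun_apply v x) = norm (blinfun_apply p x)" for x
      using v v' unfolding isometry_on_def K_def by (metis rangeI)
    have uu: "adj u o\<^sub>L u = q" and vv: "adj v o\<^sub>L v = p"
      using adj_compose_self_cong[OF _ q'(1) norm_u] adj_compose_self_cong[OF _ p'(1) norm_v] u' v'
      by simp_all
    define V where "V = u + v"
    have V_bop: "V \<in> bop UNIV UNIV" and adj_V: "adj V = adj u + adj v"
      using u' v' by (simp_all add: V_def adj_add)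
    have "norm (blinfun_apply V x) = norm x" for x
    proof -
      \<comment> \<open>\<open>u x\<close> lies in \<open>H\<close> and \<open>v x\<close> in
        \<open>K\<close>, so Pythagoras applies both to \<open>V x\<close> and to x = p x + q
        x.\<close>
      have "inner (blinfun_apply u x) (blinfun_apply v x) = 0"
        using orth[of "blinfun_apply u x" "blinfun_apply v x"] u' v' by simp
      then have "(norm (blinfun_apply V x))\<^sup>2 = (norm (blinfun_apply q x))\<^sup>2 + (norm (blinfun_apply p x))\<^sup>2"
        by (simp add: V_def blinfun.add_left inner_add_left inner_add_right inner_commute
            power2_norm_eq_inner flip: norm_u norm_v)
      also have "\<dots> = (norm (blinfun_apply p x + blinfun_apply q x))\<^sup>2"
        using orth[of x x]
        by (simp add: power2_norm_eq_inner inner_add_left inner_add_right inner_commute)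
      finally show ?thesis
        by (simp add: sum)
    qed
    with V_bop have V: "isometry_on UNIV V"
      by (simp add: isometry_on_def)
    \<comment> \<open>Of the four terms of V* (\<theta> t) V only one survives:
      \<open>\<theta> t\<close> kills the range of \<open>v\<close>, and \<open>adj u\<close> kills
      the range of \<open>\<theta> t\<close>.\<close>
    have V\<theta>: "adj V o\<^sub>L \<theta> t o\<^sub>L V = adj v o\<^sub>L \<theta> t o\<^sub>L u" if "t \<in> T" for t
    proof (rule blinfun_eqI)
      fix x
      note \<theta>t = \<theta>_bop[OF that, unfolded bop_HK]
      have "blinfun_apply (\<theta> t) (blinfun_apply v x) = 0"
        by (rule comp0[of _ q p]) (use \<theta>t v' in simp_all)
      moreover have "blinfun_apply (adj u) (blinfun_apply (\<theta> t) y) = 0" for y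
        by (rule comp0[of _ q p]) (use \<theta>t u' in simp_all)
      ultimately show "blinfun_apply (adj V o\<^sub>L \<theta> t o\<^sub>L V) x = blinfun_apply (adj v o\<^sub>L \<theta> t o\<^sub>L u) x"
        by (simp add: adj_V) (simp add: V_def blinfun.add_left blinfun.add_right)
    qed
    have "adj V o\<^sub>L \<omega> s o\<^sub>L V = \<omega> s" if sS: "s \<in> S" for s
    proof -
      obtain l x y m where s: "s = paulsen_elem l x y m" and xy: "x \<in> X" "y \<in> X"
        using sS by (auto simp: S_def paulsen_system_def)
      have \<theta>x: "adj V o\<^sub>L \<theta> x o\<^sub>L V = \<theta> x" and \<theta>y: "adj V o\<^sub>L \<theta> y o\<^sub>L V = \<theta> y"
        using V\<theta> uv xy XT by auto
      \<comment> \<open>The lower left entry is handled by taking adjoints of the identity for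
        \<open>y\<close>.\<close>
      have \<theta>y': "adj V o\<^sub>L (adj (\<theta> y) o\<^sub>L V) = adj (\<theta> y)"
        using arg_cong[OF \<theta>y, of adj] V_bop \<theta>_bop[of y] xy XT by (auto simp: adj_compose bop_HK)
      have V0: "blinfun_apply (adj u) (blinfun_apply v z) = 0" "blinfun_apply (adj v) (blinfun_apply u z) = 0"
        "blinfun_apply p (blinfun_apply u z) = 0" "blinfun_apply q (blinfun_apply v z) = 0" for z
        by (rule comp0[of _ p q] comp0[of _ q p]; use u' v' in simp)+
      \<comment> \<open>The diagonal entries are preserved because compressing \<open>p\<close> by
        \<open>V\<close> gives v* v = p, and compressing \<open>q\<close> gives u* u = q.\<close>
      have "blinfun_apply p (blinfun_apply V z) = blinfun_apply v z"
        "blinfun_apply q (blinfun_apply V z) = blinfun_apply u z" for z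
        using u' v' V0 by (simp_all add: V_def blinfun.add_left blinfun.add_right)
      moreover have "blinfun_apply (adj v) (blinfun_apply v z) = blinfun_apply p z"
        "blinfun_apply (adj u) (blinfun_apply u z) = blinfun_apply q z" for z
        using uu vv by (metis blinfun_apply_blinfun_compose)+
      ultimately have Vp: "blinfun_apply (adj V) (blinfun_apply p (blinfun_apply V z)) = blinfun_apply p z"
        and Vq: "blinfun_apply (adj V) (blinfun_apply q (blinfun_apply V z)) = blinfun_apply q z" for z
        using V0 by (simp_all add: adj_V blinfun.add_left)
      have V\<theta>x: "blinfun_apply (adj V) (blinfun_apply (\<theta> x) (blinfun_apply V z)) = blinfun_apply (\<theta> x) z"
        and V\<theta>y: "blinfun_apply (adj V) (blinfun_apply (adj (\<theta> y)) (blinfun_apply V z)) =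
          blinfun_apply (adj (\<theta> y)) z" for z
        using \<theta>x \<theta>y' by (metis blinfun_apply_blinfun_compose)+
      show ?thesis
        by (rule blinfun_eqI)
          (simp add: s \<omega>_elem[OF xy] blinfun.add_left blinfun.add_right[of "adj V"]
            scaleC_blinfun.rep_eq V_bop V\<theta>x V\<theta>y Vp Vq)
    qed
    \<comment> \<open>The boundary property of \<open>\<omega>\<close> passes from \<open>S\<close>
      to the generated algebra, and in particular to the corner of \<open>t\<close>.\<close>
    then have "adj V o\<^sub>L \<theta> t o\<^sub>L V = \<theta> t"
      unfolding \<theta>_def by (rule bdry[OF V _ TA[OF t]])
    with V\<theta>[OF t] show ?thesis by simp
  qed

  have im: "irreducible_triple_morphism T H K \<theta>"
    unfolding irreducible_triple_morphism_def by (intro conjI allI impI tm, elim conjE, rule ir)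
  have "weak_boundary_triple X T H K \<theta>"
    unfolding weak_boundary_triple_def by (intro conjI allI impI ballI im, elim conjE, rule bd)
  with od rm show ?thesis
    by blast
qed

end
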